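(* Let $Z$ be one-dimensional iterated Brownian motion and $g(t,x)=P_x(\tau_{(0,1)}(Z)>t)$ for $t>0$, $x\in(0,1)$. Then for every constant $a>0$, $g$ does not satisfy the equation $a\,\frac{\partial^4 g}{\partial x^4}=\frac{\partial g}{\partial t}$ on $(0,\infty)\times(0,1)$.
   Context: Let $X^+_t,X^-_t,Y_t$ be independent one-dimensional Brownian motions started at $0$; two-sided Brownian motion is $X_t=X^+_t$ for $t\ge0$, $X_t=X^-_{-t}$ for $t<0$; iterated Brownian motion started at $x$ is $Z_t=x+X(Y_t)$, with law $P_x$. For an open set $D$, $\tau_D(Z)=\inf\{t\ge0: Z_t\notin D\}$. *)

theory Defs
  imports "HOL-Probability.Probability"
begin

definition brownian_motion :: "'a measure \<Rightarrow> (real \<Rightarrow> 'a \<Rightarrow> real) \<Rightarrow> bool" where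
  "brownian_motion M B \<longleftrightarrow>
     prob_space M \<and>
     (\<forall>t\<ge>0. B t \<in> borel_measurable M) \<and>
     (\<forall>\<omega>\<in>space M. B 0 \<omega> = 0 \<and> continuous_on {0..} (\<lambda>t. B t \<omega>)) \<and>
     (\<forall>(n::nat) (ts::nat \<Rightarrow> real). 0 \<le> ts 0 \<longrightarrow> (\<forall>i<n. ts i < ts (Suc i)) \<longrightarrow>
        prob_space.indep_vars M (\<lambda>_. borel) (\<lambda>i \<omega>. B (ts (Suc i)) \<omega> - B (ts i) \<omega>) {..<n}) \<and>
     (\<forall>s t. 0 \<le> s \<longrightarrow> s < t \<longrightarrow>
        distributed M lborel (\<lambda>\<omega>. B t \<omega> - B s \<omega>)
          (\<lambda>y. ennreal (normal_density 0 (sqrt (t - s)) y)))"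

definition indep_BMs :: "'a measure \<Rightarrow> (real \<Rightarrow> 'a \<Rightarrow> real) \<Rightarrow> (real \<Rightarrow> 'a \<Rightarrow> real)
    \<Rightarrow> (real \<Rightarrow> 'a \<Rightarrow> real) \<Rightarrow> bool" where
  "indep_BMs M Xp Xm Y \<longleftrightarrow>
     brownian_motion M Xp \<and> brownian_motion M Xm \<and> brownian_motion M Y \<and>
     prob_space.indep_vars M (\<lambda>_. PiM UNIV (\<lambda>_::real. borel))
       (\<lambda>i \<omega> t. if t \<ge> 0 then ([Xp, Xm, Y] ! i) t \<omega> else 0) {0::nat, 1, 2}"

definition two_sided :: "(real \<Rightarrow> 'a \<Rightarrow> real) \<Rightarrow> (real \<Rightarrow> 'a \<Rightarrow> real) \<Rightarrow> real \<Rightarrow> 'a \<Rightarrow> real" where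
  "two_sided Xp Xm s \<omega> = (if s \<ge> 0 then Xp s \<omega> else Xm (- s) \<omega>)"

definition ibm :: "(real \<Rightarrow> 'a \<Rightarrow> real) \<Rightarrow> (real \<Rightarrow> 'a \<Rightarrow> real) \<Rightarrow> (real \<Rightarrow> 'a \<Rightarrow> real)
    \<Rightarrow> real \<Rightarrow> real \<Rightarrow> 'a \<Rightarrow> real" where
  "ibm Xp Xm Y x t \<omega> = x + two_sided Xp Xm (Y t \<omega>) \<omega>"

text \<open>Exit time tau_D(Z) = inf {t >= 0. Z_t \<notin> D}, valued in extended reals (inf {} = \<infinity>).\<close>
definition exit_time :: "real set \<Rightarrow> (real \<Rightarrow> 'a \<Rightarrow> real) \<Rightarrow> 'a \<Rightarrow> ereal" where
  "exit_time D Z \<omega> = Inf (ereal ` {t. t \<ge> 0 \<and> Z t \<omega> \<notin> D})"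

end

theory Submission
  imports Defs
begin

text \<open>Since \<open>g\<close> decreases in \<open>t\<close>, the equation with \<open>a > 0\<close> would force \<open>g\<^sub>x\<^sub>x\<^sub>x\<^sub>x \<le> 0\<close>. A nonnegative
  function on \<open>(0,1)\<close> with nonpositive fourth derivative that vanishes to more than first order at
  both endpoints is zero (the clamped fourth-order problem has a positive Green function). But \<open>g\<close>
  is \<open>O(x\<^sup>4\<^sup>/\<^sup>3)\<close> at the boundary: \<open>Z\<close> survives near an endpoint only if both
  branches of \<open>X\<close> stay on one side, up to the events that \<open>Y\<close> stays below or above a small level. And
  \<open>g\<close> is positive at \<open>x = 1/2\<close> for small \<open>t\<close>, by continuity of the paths.\<close>

section \<open>Nonnegative functions with nonpositive fourth derivative\<close>

text \<open>Decay of more than first order is essential: \<open>x * (1 - x)\<close> is nonnegative,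
  has zero fourth derivative and decays linearly at both ends. Derivatives exist only inside the
  open interval, so the clamped conditions are imitated by Lagrange interpolation at two nodes near
  each endpoint, which uses only interior values. The exponent 4/3 comes from an auxiliary level h.
  A given branch of X stays on the required side of distance x up to time h with probability of
  order x / sqrt h; Y stays on a given side of level h up to a fixed time with probability of order
  h. For h = x^(2/3) both orders are x^(2/3). Survival forces two of these events at once, and
  independence multiplies their probabilities. The one pair without independence consists of two
  events about Y and is estimated directly. Staying below a level is imposed only at finitely many
  times. Such events are measurable in the product space of paths in which the independence of the
  three processes is formulated.\<close>

lemma Rolle_open_interval:
  fixes f f' :: "real \<Rightarrow> real"
  assumes deriv: "\<And>x. x \<in> {u<..<v} \<Longrightarrow> (f has_real_derivative f' x) (at x)"
    and pq: "u < p" "p < q" "q < v" "f p = 0" "f q = 0"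
  obtains z where "p < z" "z < q" "f' z = 0"
proof -
  have "continuous_on {p..q} f"
    using deriv pq by (intro DERIV_atLeastAtMost_imp_continuous_on) (meson dual_order.strict_trans1 dual_order.strict_trans2 greaterThanLessThan_iff)
  moreover have "f differentiable (at x)" if "p < x" "x < q" for x
    using deriv[of x] that pq by (auto simp: real_differentiable_def)
  ultimately obtain z where z: "p < z" "z < q" "DERIV f z :> 0"
    using Rolle[of p q f] pq by auto
  moreover have "(f has_real_derivative f' z) (at z)"
    using deriv z pq by auto
  then have "f' z = 0"
    using DERIV_unique z(3) by blast
  ultimately show thesis using that by blast
qed

text \<open>Rolle's theorem between neighbouring zeros turns five zeros into four, three, two and
  finally one.\<close>

lemma fourth_derivative_root:
  fixes f f1 f2 f3 f4 :: "real \<Rightarrow> real"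
  assumes d: "\<And>x. x \<in> {u<..<v} \<Longrightarrow> (f has_real_derivative f1 x) (at x)"
      "\<And>x. x \<in> {u<..<v} \<Longrightarrow> (f1 has_real_derivative f2 x) (at x)"
      "\<And>x. x \<in> {u<..<v} \<Longrightarrow> (f2 has_real_derivative f3 x) (at x)"
      "\<And>x. x \<in> {u<..<v} \<Longrightarrow> (f3 has_real_derivative f4 x) (at x)"
    and x: "u < x1" "x1 < x2" "x2 < x3" "x3 < x4" "x4 < x5" "x5 < v"
      "f x1 = 0" "f x2 = 0" "f x3 = 0" "f x4 = 0" "f x5 = 0"
  obtains z where "z \<in> {u<..<v}" "f4 z = 0"
proof -
  obtain y1 where y1: "x1 < y1" "y1 < x2" "f1 y1 = 0"
    by (rule Rolle_open_interval[of u v f f1 x1 x2, OF d(1)])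
      (assumption | use x in linarith)+
  obtain y2 where y2: "x2 < y2" "y2 < x3" "f1 y2 = 0"
    by (rule Rolle_open_interval[of u v f f1 x2 x3, OF d(1)])
      (assumption | use x in linarith)+
  obtain y3 where y3: "x3 < y3" "y3 < x4" "f1 y3 = 0"
    by (rule Rolle_open_interval[of u v f f1 x3 x4, OF d(1)])
      (assumption | use x in linarith)+
  obtain y4 where y4: "x4 < y4" "y4 < x5" "f1 y4 = 0"
    by (rule Rolle_open_interval[of u v f f1 x4 x5, OF d(1)])
      (assumption | use x in linarith)+
  obtain z1 where z1: "y1 < z1" "z1 < y2" "f2 z1 = 0"
    by (rule Rolle_open_interval[of u v f1 f2 y1 y2, OF d(2)])
      (assumption | use x y1 y2 in linarith)+
  obtain z2 where z2: "y2 < z2" "z2 < y3" "f2 z2 = 0"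
    by (rule Rolle_open_interval[of u v f1 f2 y2 y3, OF d(2)])
      (assumption | use x y2 y3 in linarith)+
  obtain z3 where z3: "y3 < z3" "z3 < y4" "f2 z3 = 0"
    by (rule Rolle_open_interval[of u v f1 f2 y3 y4, OF d(2)])
      (assumption | use x y3 y4 in linarith)+
  obtain w1 where w1: "z1 < w1" "w1 < z2" "f3 w1 = 0"
    by (rule Rolle_open_interval[of u v f2 f3 z1 z2, OF d(3)])
      (assumption | use x y1 y2 y3 z1 z2 in linarith)+
  obtain w2 where w2: "z2 < w2" "w2 < z3" "f3 w2 = 0"
    by (rule Rolle_open_interval[of u v f2 f3 z2 z3, OF d(3)])
      (assumption | use x y2 y3 y4 z2 z3 in linarith)+
  obtain z where z: "w1 < z" "z < w2" "f4 z = 0"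
    by (rule Rolle_open_interval[of u v f3 f4 w1 w2, OF d(4)])
      (assumption | use x y1 y4 z1 z3 w1 w2 in linarith)+
  moreover have "u < z" "z < v" using x y1 y4 z1 z3 w1 w2 z by linarith+
  ultimately show thesis using that by auto
qed

lemma pderiv4_quartic:
  "pderiv (pderiv (pderiv (pderiv [:a, b, c, d, e::real:]))) = [:24 * e:]"
  by (simp add: pderiv_pCons)

text \<open>The Lagrange interpolant of \<open>f\<close> at \<open>p1 < p2 < q2 < q1\<close> dominates \<open>f\<close> between \<open>p2\<close> and
  \<open>q2\<close>, because the nodal polynomial is positive there; the contributions of the two outer nodes
  are nonpositive and have been dropped.\<close>

lemma four_node_bound:
  fixes f f1 f2 f3 f4 :: "real \<Rightarrow> real"
  assumes d: "\<And>x. x \<in> {u<..<v} \<Longrightarrow> (f has_real_derivative f1 x) (at x)"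
      "\<And>x. x \<in> {u<..<v} \<Longrightarrow> (f1 has_real_derivative f2 x) (at x)"
      "\<And>x. x \<in> {u<..<v} \<Longrightarrow> (f2 has_real_derivative f3 x) (at x)"
      "\<And>x. x \<in> {u<..<v} \<Longrightarrow> (f3 has_real_derivative f4 x) (at x)"
    and f4: "\<And>x. x \<in> {u<..<v} \<Longrightarrow> f4 x \<le> 0"
    and f: "\<And>x. x \<in> {u<..<v} \<Longrightarrow> 0 \<le> f x"
    and x: "u < p1" "p1 < p2" "p2 < x" "x < q2" "q2 < q1" "q1 < v"
  shows "f x \<le> f p2 * ((x - p1) * (q2 - x) * (q1 - x) / ((p2 - p1) * (q2 - p2) * (q1 - p2)))
             + f q2 * ((x - p1) * (x - p2) * (q1 - x) / ((q2 - p1) * (q2 - p2) * (q1 - q2)))"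
proof -
  define l :: "real \<Rightarrow> real \<Rightarrow> real \<Rightarrow> real poly"
    where "l = (\<lambda>a b c. [:-a, 1:] * [:-b, 1:] * [:-c, 1:])"
  define w where "w = [:-p1, 1:] * [:-p2, 1:] * [:-q2, 1:] * [:-q1, 1::real:]"
  define L where "L = smult (f p1 / ((p1 - p2) * (p1 - q2) * (p1 - q1))) (l p2 q2 q1)
     + smult (f p2 / ((p2 - p1) * (p2 - q2) * (p2 - q1))) (l p1 q2 q1)
     + smult (f q2 / ((q2 - p1) * (q2 - p2) * (q2 - q1))) (l p1 p2 q1)
     + smult (f q1 / ((q1 - p1) * (q1 - p2) * (q1 - q2))) (l p1 p2 q2)"
  have poly_l: "poly (l a b c) y = (y - a) * (y - b) * (y - c)" for a b c y
    by (simp add: l_def algebra_simps)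
  have poly_w: "poly w y = (y - p1) * (y - p2) * (y - q2) * (y - q1)" for y
    by (simp add: w_def algebra_simps)
  have w_pos: "0 < poly w x"
    unfolding poly_w using x by (intro mult_neg_neg mult_pos_neg mult_pos_pos) auto
  \<comment> \<open>\<open>K\<close> makes \<open>f - Q\<close> vanish at \<open>x\<close> as well,
    which gives the fifth zero. The fourth derivative of \<open>Q\<close> is \<open>24 * K\<close>,
    so the sign of \<open>f4\<close> determines that of \<open>K\<close> and hence of the
    interpolation error.\<close>
  define K where "K = (f x - poly L x) / poly w x"
  define Q where "Q = L + smult K w"
  have node: "poly L p1 = f p1" "poly L p2 = f p2" "poly L q2 = f q2" "poly L q1 = f q1"
    using x by (simp_all add: L_def poly_l)
  have roots: "f p1 - poly Q p1 = 0" "f p2 - poly Q p2 = 0" "f x - poly Q x = 0"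
      "f q2 - poly Q q2 = 0" "f q1 - poly Q q1 = 0"
    using w_pos node by (simp_all add: Q_def K_def poly_w)
  \<comment> \<open>The trailing 0 pads the cubics to five coefficients, so that
    \<open>pderiv4_quartic\<close> rewrites them and \<open>w\<close> alike.\<close>
  have l_coeffs: "l a b c = [:- (a * b * c), a * b + a * c + b * c, - (a + b + c), 1, 0:]" for a b c
    by (simp add: l_def algebra_simps)
  have w_coeffs: "w = [:p1 * p2 * q2 * q1, - (p1 * p2 * q2 + p1 * p2 * q1 + p1 * q2 * q1 + p2 * q2 * q1),
      p1 * p2 + p1 * q2 + p1 * q1 + p2 * q2 + p2 * q1 + q2 * q1, - (p1 + p2 + q2 + q1), 1:]"
    by (simp add: w_def algebra_simps)
  have Q4: "pderiv (pderiv (pderiv (pderiv Q))) = [:24 * K:]"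
    unfolding Q_def L_def l_coeffs w_coeffs by (simp only: pderiv_add pderiv_smult pderiv4_quartic) simp
  obtain z where z: "z \<in> {u<..<v}" "f4 z - poly (pderiv (pderiv (pderiv (pderiv Q)))) z = 0"
    by (rule fourth_derivative_root[of u v "\<lambda>y. f y - poly Q y" "\<lambda>y. f1 y - poly (pderiv Q) y"
        "\<lambda>y. f2 y - poly (pderiv (pderiv Q)) y" "\<lambda>y. f3 y - poly (pderiv (pderiv (pderiv Q))) y"
        "\<lambda>y. f4 y - poly (pderiv (pderiv (pderiv (pderiv Q)))) y" p1 p2 x q2 q1])
      (use d x roots in \<open>auto intro!: DERIV_diff poly_DERIV\<close>)
  then have "K \<le> 0" using f4[of z] Q4 by simp
  then have "f x \<le> poly L x"
    using w_pos by (simp add: K_def divide_le_0_iff)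
  also have "poly L x = f p1 * ((x - p2) * (x - q2) * (x - q1) / ((p1 - p2) * (p1 - q2) * (p1 - q1)))
     + f p2 * ((x - p1) * (x - q2) * (x - q1) / ((p2 - p1) * (p2 - q2) * (p2 - q1)))
     + f q2 * ((x - p1) * (x - p2) * (x - q1) / ((q2 - p1) * (q2 - p2) * (q2 - q1)))
     + f q1 * ((x - p1) * (x - p2) * (x - q2) / ((q1 - p1) * (q1 - p2) * (q1 - q2)))"
    by (simp add: L_def poly_l)
  also have "f p1 * ((x - p2) * (x - q2) * (x - q1) / ((p1 - p2) * (p1 - q2) * (p1 - q1))) \<le> 0"
    using x f[of p1] by (intro mult_nonneg_nonpos divide_nonneg_neg mult_nonpos_nonpos mult_nonneg_nonpos
        mult_pos_neg mult_neg_neg) (auto simp: mult_less_0_iff zero_less_mult_iff)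
  also have "f q1 * ((x - p1) * (x - p2) * (x - q2) / ((q1 - p1) * (q1 - p2) * (q1 - q2))) \<le> 0"
    using x f[of q1] by (intro mult_nonneg_nonpos divide_nonpos_pos mult_nonneg_nonpos) auto
  also have "(x - p1) * (x - q2) * (x - q1) / ((p2 - p1) * (p2 - q2) * (p2 - q1))
      = (x - p1) * (q2 - x) * (q1 - x) / ((p2 - p1) * (q2 - p2) * (q1 - p2))"
    using x by (simp add: divide_simps) (simp add: algebra_simps)
  also have "(x - p1) * (x - p2) * (x - q1) / ((q2 - p1) * (q2 - p2) * (q2 - q1))
      = (x - p1) * (x - p2) * (q1 - x) / ((q2 - p1) * (q2 - p2) * (q1 - q2))"
    using x by (simp add: divide_simps) (simp add: algebra_simps)
  finally show ?thesis by simp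
qed

text \<open>Interpolation at e/2, e, 1 - e and 1 - e/2 leaves only the values at e and 1 - e. The
  short gaps e/2 make their weights of order 1/e, which is exactly what decay faster than linear
  absorbs as e tends to 0.\<close>

lemma nonneg_fourth_derivative_nonpos_imp_zero:
  fixes f f1 f2 f3 f4 :: "real \<Rightarrow> real"
  assumes d: "\<And>x. x \<in> {0<..<1} \<Longrightarrow> (f has_real_derivative f1 x) (at x)"
      "\<And>x. x \<in> {0<..<1} \<Longrightarrow> (f1 has_real_derivative f2 x) (at x)"
      "\<And>x. x \<in> {0<..<1} \<Longrightarrow> (f2 has_real_derivative f3 x) (at x)"
      "\<And>x. x \<in> {0<..<1} \<Longrightarrow> (f3 has_real_derivative f4 x) (at x)"
    and f4: "\<And>x. x \<in> {0<..<1} \<Longrightarrow> f4 x \<le> 0"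
    and f: "\<And>x. x \<in> {0<..<1} \<Longrightarrow> 0 \<le> f x"
    and left: "((\<lambda>x. f x / x) \<longlongrightarrow> 0) (at_right 0)"
    and right: "((\<lambda>x. f (1 - x) / x) \<longlongrightarrow> 0) (at_right 0)"
    and x: "x \<in> {0<..<1}"
  shows "f x = 0"
proof -
  have est: "f x \<le> 8 * (f e / e) + 8 * (f (1 - e) / e)"
    if e: "0 < e" "e < 1/4" "e < x" "e < 1 - x" for e
  proof -
    \<comment> \<open>Here \<open>s\<close> and \<open>t\<close> stand for \<open>1 - 2*e\<close>
      and \<open>1 - 3*e/2\<close>, both at least 1/2 because \<open>e < 1/4\<close>; the three
      factors of 2 give the 8.\<close>
    have coeff: "p * q * r / (e/2 * s * t) \<le> 8 / e"
      if "0 \<le> p" "p \<le> 1" "0 \<le> q" "q \<le> 1" "0 \<le> r" "r \<le> 1" "1/2 \<le> s" "1/2 \<le> t" for p q r s t :: real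
    proof -
      have "p * q * r \<le> 1 * 1 * 1" using that by (intro mult_mono) auto
      moreover have "e/2 * (1/2) * (1/2) \<le> e/2 * s * t" using that e by (intro mult_mono) auto
      ultimately have "p * q * r / (e/2 * s * t) \<le> 1 / (e/2 * (1/2) * (1/2))"
        using e by (intro frac_le) auto
      then show ?thesis by simp
    qed
    have "f x \<le> f e * ((x - e/2) * (1 - e - x) * (1 - e/2 - x) / ((e - e/2) * (1 - e - e) * (1 - e/2 - e)))
      + f (1 - e) * ((x - e/2) * (x - e) * (1 - e/2 - x) / ((1 - e - e/2) * (1 - e - e) * (1 - e/2 - (1 - e))))"
      by (rule four_node_bound[OF d f4 f]) (use e in auto)
    also have "\<dots> = f e * ((x - e/2) * (1 - e - x) * (1 - e/2 - x) / (e/2 * (1 - 2*e) * (1 - 3*e/2)))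
      + f (1 - e) * ((x - e/2) * (x - e) * (1 - e/2 - x) / (e/2 * (1 - 2*e) * (1 - 3*e/2)))"
      by (simp add: algebra_simps)
    also have "\<dots> \<le> f e * (8 / e) + f (1 - e) * (8 / e)"
      using e x f[of e] f[of "1 - e"] by (intro add_mono mult_left_mono coeff) auto
    finally show ?thesis by (simp add: mult.commute)
  qed
  have "((\<lambda>e. 8 * (f e / e) + 8 * (f (1 - e) / e)) \<longlongrightarrow> 8 * 0 + 8 * 0) (at_right 0)"
    by (intro tendsto_intros left right)
  moreover have "eventually (\<lambda>e. e \<in> {0<..<min (1/4) (min x (1 - x))}) (at_right 0)"
    using x by (intro eventually_at_right_real) auto
  then have "eventually (\<lambda>e. f x \<le> 8 * (f e / e) + 8 * (f (1 - e) / e)) (at_right 0)"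
    by eventually_elim (use est in auto)
  ultimately have "f x \<le> 8 * 0 + 8 * 0"
    by (rule tendsto_lowerbound) auto
  then show ?thesis using f[OF x] by simp
qed

section \<open>The reflection principle for Brownian motion\<close>

text \<open>Since \<open>sqrt (2 * pi) \<ge> 2\<close>, the density is at most
  \<open>1 / (2 * \<sigma>)\<close>, and the interval has length \<open>2 * r\<close>.\<close>

lemma (in prob_space) centered_normal_prob_abs_less:
  assumes D: "distributed M lborel D (\<lambda>y. ennreal (normal_density 0 \<sigma> y))" and "\<sigma> > 0" "r \<ge> 0"
  shows "prob {\<omega>\<in>space M. \<bar>D \<omega>\<bar> < r} \<le> r / \<sigma>"
proof -
  have dens: "normal_density 0 \<sigma> y \<le> 1 / (2 * \<sigma>)" for y
  proof -
    have "2 * \<sigma> \<le> sqrt (2 * pi) * \<sigma>"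
      using \<open>\<sigma> > 0\<close> pi_gt3 by (intro mult_right_mono real_le_rsqrt) auto
    then have "normal_density 0 \<sigma> y \<le> 1 / (sqrt (2 * pi) * \<sigma>) * 1"
      using \<open>\<sigma> > 0\<close> unfolding normal_density_def by (intro mult_mono) (auto simp: real_sqrt_mult)
    also have "\<dots> \<le> 1 / (2 * \<sigma>)"
      using \<open>2 * \<sigma> \<le> _\<close> \<open>\<sigma> > 0\<close> by (auto intro!: frac_le)
    finally show ?thesis .
  qed
  have "emeasure M (D -` {-r<..<r} \<inter> space M) = (\<integral>\<^sup>+x. ennreal (normal_density 0 \<sigma> x) * indicator {-r<..<r} x \<partial>lborel)"
    using D by (intro distributed_emeasure) auto
  also have "\<dots> \<le> (\<integral>\<^sup>+x. ennreal (1 / (2 * \<sigma>)) * indicator {-r<..<r} x \<partial>lborel)"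
    using dens by (intro nn_integral_mono mult_right_mono ennreal_leI) auto
  also have "\<dots> = ennreal (1 / (2 * \<sigma>)) * ennreal (2 * r)"
    using \<open>r \<ge> 0\<close> by (simp add: nn_integral_cmult)
  also have "\<dots> = ennreal (r / \<sigma>)"
    using assms by (simp flip: ennreal_mult)
  finally have "prob (D -` {-r<..<r} \<inter> space M) \<le> r / \<sigma>"
    using assms by (simp add: emeasure_eq_measure)
  also have "D -` {-r<..<r} \<inter> space M = {\<omega>\<in>space M. \<bar>D \<omega>\<bar> < r}" by (auto simp: abs_less_iff)
  finally show ?thesis .
qed

lemma (in prob_space) centered_normal_uminus:
  assumes "distributed M lborel D (\<lambda>y. ennreal (normal_density 0 \<sigma> y))" and "\<sigma> > 0"
  shows "distributed M lborel (\<lambda>\<omega>. - D \<omega>) (\<lambda>y. ennreal (normal_density 0 \<sigma> y))"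
  using normal_density_affine[OF assms, of "-1" 0] by simp

lemma (in prob_space) centered_normal_prob_symmetric:
  assumes D: "distributed M lborel D (\<lambda>y. ennreal (normal_density 0 \<sigma> y))" and "\<sigma> > 0" "A \<in> sets borel"
  shows "prob {\<omega>\<in>space M. - D \<omega> \<in> A} = prob {\<omega>\<in>space M. D \<omega> \<in> A}"
proof -
  note D' = centered_normal_uminus[OF D \<open>\<sigma> > 0\<close>]
  have "emeasure M ((\<lambda>\<omega>. - D \<omega>) -` A \<inter> space M) = emeasure M (D -` A \<inter> space M)"
    using \<open>A \<in> sets borel\<close> by (simp add: distributed_emeasure[OF D] distributed_emeasure[OF D'])
  then have "prob ((\<lambda>\<omega>. - D \<omega>) -` A \<inter> space M) = prob (D -` A \<inter> space M)"
    by (simp add: measure_def)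
  then show ?thesis by (simp add: vimage_def Int_def conj_commute)
qed

text \<open>By symmetry the mass outside \<open>\<bar>D\<bar> < r\<close> is shared equally by the
  two tails, and the mass inside is at most \<open>r / \<sigma>\<close>.\<close>

lemma (in prob_space) centered_normal_prob_ge:
  assumes D: "distributed M lborel D (\<lambda>y. ennreal (normal_density 0 \<sigma> y))" and "\<sigma> > 0" "r > 0"
  shows "1 - r / \<sigma> \<le> 2 * prob {\<omega>\<in>space M. r \<le> D \<omega>}"
proof -
  have [measurable]: "D \<in> borel_measurable M" using D by (auto simp: distributed_def)
  have "1 = prob (space M)" by (simp add: prob_space)
  also have "space M = {\<omega>\<in>space M. - D \<omega> \<in> {r..}} \<union> {\<omega>\<in>space M. D \<omega> \<in> {r..}} \<union> {\<omega>\<in>space M. \<bar>D \<omega>\<bar> < r}"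
    by auto
  also have "prob \<dots> \<le> prob {\<omega>\<in>space M. - D \<omega> \<in> {r..}} + prob {\<omega>\<in>space M. D \<omega> \<in> {r..}} + prob {\<omega>\<in>space M. \<bar>D \<omega>\<bar> < r}"
    by (intro order.trans[OF measure_Un_le] add_right_mono order.refl) measurable
  finally show ?thesis
    using centered_normal_prob_symmetric[OF D \<open>\<sigma> > 0\<close>, of "{r..}"] centered_normal_prob_abs_less[OF D \<open>\<sigma> > 0\<close>, of r] \<open>r > 0\<close>
    by simp
qed

lemma (in prob_space) centered_normal_prob_pos:
  assumes D: "distributed M lborel D (\<lambda>y. ennreal (normal_density 0 \<sigma> y))" and "\<sigma> > 0"
  shows "2 * prob {\<omega>\<in>space M. 0 < D \<omega>} \<le> 1"
proof -
  have [measurable]: "D \<in> borel_measurable M" using D by (auto simp: distributed_def)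
  have "prob {\<omega>\<in>space M. - D \<omega> \<in> {0<..}} + prob {\<omega>\<in>space M. D \<omega> \<in> {0<..}}
      = prob ({\<omega>\<in>space M. - D \<omega> \<in> {0<..}} \<union> {\<omega>\<in>space M. D \<omega> \<in> {0<..}})"
    by (intro finite_measure_Union[symmetric]) auto
  also have "\<dots> \<le> 1" by simp
  finally show ?thesis using centered_normal_prob_symmetric[OF D \<open>\<sigma> > 0\<close>, of "{0<..}"] by simp
qed

section \<open>Brownian increments, first passage on a grid and small steps\<close>

lemma brownian_motionD:
  assumes "brownian_motion M B"
  shows "prob_space M"
    and "t \<ge> 0 \<Longrightarrow> B t \<in> borel_measurable M"
    and "\<omega> \<in> space M \<Longrightarrow> B 0 \<omega> = 0"
    and "\<omega> \<in> space M \<Longrightarrow> continuous_on {0..} (\<lambda>t. B t \<omega>)"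
    and "\<lbrakk>0 \<le> ts 0; \<And>i. i < n \<Longrightarrow> ts i < ts (Suc i)\<rbrakk> \<Longrightarrow>
      prob_space.indep_vars M (\<lambda>_. borel) (\<lambda>i \<omega>. B (ts (Suc i)) \<omega> - B (ts i) \<omega>) {..<n}"
    and "\<lbrakk>0 \<le> s; s < t\<rbrakk> \<Longrightarrow> distributed M lborel (\<lambda>\<omega>. B t \<omega> - B s \<omega>)
          (\<lambda>y. ennreal (normal_density 0 (sqrt (t - s)) y))"
  using assms unfolding brownian_motion_def by blast+

lemma brownian_motion_uminus:
  assumes B: "brownian_motion M B"
  shows "brownian_motion M (\<lambda>t \<omega>. - B t \<omega>)"
proof -
  interpret prob_space M using brownian_motionD(1)[OF B] .
  have "indep_vars (\<lambda>_. borel) (\<lambda>i \<omega>. - B (ts (Suc i)) \<omega> - - B (ts i) \<omega>) {..<n}"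
    if "0 \<le> ts 0" "\<And>i. i < n \<Longrightarrow> ts i < ts (Suc i)" for n and ts :: "nat \<Rightarrow> real"
    using indep_vars_compose2[OF brownian_motionD(5)[OF B that], where Y = "\<lambda>_ x. - x" and N = "\<lambda>_. borel"]
    by (simp add: algebra_simps)
  moreover have "distributed M lborel (\<lambda>\<omega>. - B t \<omega> - - B s \<omega>)
          (\<lambda>y. ennreal (normal_density 0 (sqrt (t - s)) y))" if "0 \<le> s" "s < t" for s t
    using centered_normal_uminus[OF brownian_motionD(6)[OF B that]] that by simp
  ultimately show ?thesis
    using brownian_motionD(2-4)[OF B] prob_space_axioms
    unfolding brownian_motion_def by (auto intro!: continuous_intros)
qed

text \<open>First passage at index \<open>k\<close> is decided by the increments before
  \<open>t k\<close>, because \<open>B (t j)\<close> is their partial sum. The last increment, up to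
  \<open>T\<close>, is independent of them.\<close>

lemma brownian_motion_first_passage_indep:
  assumes B: "brownian_motion M B" and t: "t 0 = 0" "\<And>i. i < k \<Longrightarrow> t i < t (Suc i)" "t k < T"
  shows "measure M {\<omega>\<in>space M. x \<le> B (t k) \<omega> \<and> (\<forall>j<k. B (t j) \<omega> < x) \<and> 0 < B T \<omega> - B (t k) \<omega>}
    = measure M {\<omega>\<in>space M. x \<le> B (t k) \<omega> \<and> (\<forall>j<k. B (t j) \<omega> < x)} *
      measure M {\<omega>\<in>space M. 0 < B T \<omega> - B (t k) \<omega>}" (is "measure M ?AD = measure M ?A * measure M ?D")
proof -
  interpret prob_space M using brownian_motionD(1)[OF B] .
  \<comment> \<open>The grid jumps from \<open>t k\<close> straight to \<open>T\<close>, so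
    increment number \<open>k\<close> is the whole remaining one.\<close>
  define ts where "ts i = (if i \<le> k then t i else T)" for i
  define X where "X i \<omega> = B (ts (Suc i)) \<omega> - B (ts i) \<omega>" for i \<omega>
  have ind: "indep_vars (\<lambda>_. borel) X {..<Suc k}"
    unfolding X_def using t by (intro brownian_motionD(5)[OF B]) (auto simp: ts_def less_Suc_eq)
  let ?P = "PiM {..<k} (\<lambda>_. borel :: real measure)" and ?Q = "PiM {k} (\<lambda>_. borel :: real measure)"
  have sum_meas: "(\<lambda>v. \<Sum>i<j. v i) \<in> borel_measurable ?P" if "j \<le> k" for j
    using that by (intro borel_measurable_sum measurable_component_singleton) auto
  define a where "a = {v\<in>space ?P. x \<le> (\<Sum>i<k. v i) \<and> (\<forall>j\<in>{..<k}. (\<Sum>i<j. v i) < x)}"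
  define d where "d = {v\<in>space ?Q. 0 < v k}"
  have a: "a \<in> sets ?P"
    unfolding a_def by (intro sets.sets_Collect_conj sets.sets_Collect_finite_All borel_measurable_le borel_measurable_less
        borel_measurable_const sum_meas) auto
  have d: "d \<in> sets ?Q" unfolding d_def by measurable
  have sum: "(\<Sum>i<j. X i \<omega>) = B (t j) \<omega>" if "j \<le> k" "\<omega> \<in> space M" for j \<omega>
    unfolding X_def using sum_lessThan_telescope[of "\<lambda>i. B (ts i) \<omega>" j] that t brownian_motionD(3)[OF B]
    by (simp add: ts_def)
  have A: "(\<lambda>\<omega>. \<lambda>i\<in>{..<k}. X i \<omega>) -` a \<inter> space M = ?A"
    using sum by (auto simp: a_def space_PiM)
  have D: "(\<lambda>\<omega>. \<lambda>i\<in>{k}. X i \<omega>) -` d \<inter> space M = ?D"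
    by (auto simp: d_def space_PiM X_def ts_def)
  have "prob ((\<lambda>\<omega>. (\<lambda>i\<in>{..<k}. X i \<omega>, \<lambda>i\<in>{k}. X i \<omega>)) -` (a \<times> d) \<inter> space M)
      = prob ((\<lambda>\<omega>. \<lambda>i\<in>{..<k}. X i \<omega>) -` a \<inter> space M) * prob ((\<lambda>\<omega>. \<lambda>i\<in>{k}. X i \<omega>) -` d \<inter> space M)"
    using indep_var_restrict[OF ind, of "{..<k}" "{k}"] a d by (intro indep_varD) auto
  also have "(\<lambda>\<omega>. (\<lambda>i\<in>{..<k}. X i \<omega>, \<lambda>i\<in>{k}. X i \<omega>)) -` (a \<times> d) \<inter> space M = ?A \<inter> ?D"
    unfolding A[symmetric] D[symmetric] by auto
  also have "?A \<inter> ?D = ?AD" by auto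
  finally show ?thesis unfolding A D .
qed

text \<open>The reflection principle on a grid: at the first grid time with \<open>x \<le> B\<close> the remaining increment
  is positive with probability one half, and the overshoot exceeds \<open>\<epsilon>\<close> only if some step does.\<close>

lemma brownian_motion_grid_reflection:
  assumes B: "brownian_motion M B" and "0 < T" "0 < n" "0 < x" "0 < \<epsilon>"
  shows "measure M {\<omega>\<in>space M. \<forall>k\<le>n. B (real k * T / real n) \<omega> < x}
    \<le> (x + \<epsilon>) / sqrt T
      + 2 * measure M {\<omega>\<in>space M. \<exists>k<n. \<epsilon> < \<bar>B (real (Suc k) * T / real n) \<omega> - B (real k * T / real n) \<omega>\<bar>}"
proof -
  interpret prob_space M using brownian_motionD(1)[OF B] .
  define t where "t k = real k * T / real n" for k
  have t0: "t 0 = 0" and tn: "t n = T" using assms by (auto simp: t_def)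
  have t_less: "t i < t j" if "i < j" for i j
    using that assms by (auto simp: t_def intro!: divide_strict_right_mono mult_strict_right_mono)
  have [measurable]: "B (t k) \<in> borel_measurable M" for k
    using brownian_motionD(2)[OF B] assms by (simp add: t_def)
  have [measurable]: "B T \<in> borel_measurable M"
    using brownian_motionD(2)[OF B] assms by simp
  define N where "N = {\<omega>\<in>space M. \<forall>k\<le>n. B (t k) \<omega> < x}"
  define big where "big = {\<omega>\<in>space M. \<exists>k<n. \<epsilon> < \<bar>B (t (Suc k)) \<omega> - B (t k) \<omega>\<bar>}"
  define A where "A k = {\<omega>\<in>space M. x \<le> B (t k) \<omega> \<and> (\<forall>j<k. B (t j) \<omega> < x)}" for k
  define D where "D k = {\<omega>\<in>space M. x \<le> B (t k) \<omega> \<and> (\<forall>j<k. B (t j) \<omega> < x) \<and> 0 < B T \<omega> - B (t k) \<omega>}" for k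
  have meas[measurable]: "N \<in> sets M" "big \<in> sets M" "A k \<in> sets M" "D k \<in> sets M" for k
    unfolding N_def big_def A_def D_def by measurable
  have half: "2 * prob (D k) \<le> prob (A k)" if "k < n" for k
  proof -
    have "t k < T" "0 \<le> t k" using t_less[OF that] tn assms by (auto simp: t_def)
    have "2 * prob {\<omega>\<in>space M. 0 < B T \<omega> - B (t k) \<omega>} \<le> 1"
      using brownian_motionD(6)[OF B \<open>0 \<le> t k\<close> \<open>t k < T\<close>] \<open>t k < T\<close>
      by (intro centered_normal_prob_pos) auto
    moreover have "prob (D k) = prob (A k) * prob {\<omega>\<in>space M. 0 < B T \<omega> - B (t k) \<omega>}"
      unfolding D_def A_def using t0 t_less \<open>t k < T\<close> by (intro brownian_motion_first_passage_indep[OF B]) auto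
    ultimately show ?thesis
      using mult_left_mono[of "2 * prob {\<omega>\<in>space M. 0 < B T \<omega> - B (t k) \<omega>}" 1 "prob (A k)"] by simp
  qed
  have disj: "disjoint_family_on A {..<n}"
  proof -
    have "A i \<inter> A j = {}" if "i < j" for i j using that by (auto simp: A_def)
    then show ?thesis unfolding disjoint_family_on_def by (metis Int_commute linorder_neqE_nat)
  qed
  \<comment> \<open>If the first passage value lies below \<open>x + \<epsilon>\<close>, the passage
    precedes \<open>T\<close> and the path must still rise. Otherwise the last step crossed from
    below \<open>x\<close> to at least \<open>x + \<epsilon>\<close>; that step exists because
    \<open>B\<close> starts at \<open>0 < x\<close>.\<close>
  have "{\<omega>\<in>space M. x + \<epsilon> \<le> B T \<omega> - B 0 \<omega>} \<subseteq> big \<union> (\<Union>k<n. D k)"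
  proof
    fix \<omega> assume "\<omega> \<in> {\<omega>\<in>space M. x + \<epsilon> \<le> B T \<omega> - B 0 \<omega>}"
    then have \<omega>: "\<omega> \<in> space M" and ge: "x + \<epsilon> \<le> B T \<omega>" and zero: "B (t 0) \<omega> = 0"
      using brownian_motionD(3)[OF B] t0 by auto
    define k where "k = (LEAST k. x \<le> B (t k) \<omega>)"
    have "x \<le> B (t n) \<omega>" using ge tn assms by simp
    then have k: "x \<le> B (t k) \<omega>" "k \<le> n"
      unfolding k_def by (auto intro: LeastI Least_le)
    have before: "B (t j) \<omega> < x" if "j < k" for j
      using not_less_Least that unfolding k_def by fastforce
    from k zero \<open>0 < x\<close> obtain j where j: "k = Suc j" by (cases k) auto
    show "\<omega> \<in> big \<union> (\<Union>k<n. D k)"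
    proof (cases "B (t k) \<omega> < x + \<epsilon>")
      case True
      then have "k \<noteq> n" using ge tn by auto
      with True k before \<omega> ge show ?thesis by (auto simp: D_def intro!: bexI[of _ k])
    next
      case False
      then have "\<epsilon> < \<bar>B (t (Suc j)) \<omega> - B (t j) \<omega>\<bar>" using before[of j] j by simp
      with \<omega> j k show ?thesis by (auto simp: big_def)
    qed
  qed
  then have "prob {\<omega>\<in>space M. x + \<epsilon> \<le> B T \<omega> - B 0 \<omega>} \<le> prob (big \<union> (\<Union>k<n. D k))"
    by (intro finite_measure_mono) auto
  also have "\<dots> \<le> prob big + (\<Sum>k<n. prob (D k))"
    by (intro order.trans[OF measure_Un_le] add_left_mono measure_UNION_le) auto
  finally have "2 * prob {\<omega>\<in>space M. x + \<epsilon> \<le> B T \<omega> - B 0 \<omega>} \<le> 2 * prob big + (\<Sum>k<n. 2 * prob (D k))"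
    by (simp flip: sum_distrib_left)
  also have "\<dots> \<le> 2 * prob big + (\<Sum>k<n. prob (A k))"
    using half by (intro add_left_mono sum_mono) auto
  also have "(\<Sum>k<n. prob (A k)) = prob (\<Union>k<n. A k)"
    using disj by (intro finite_measure_finite_Union[symmetric]) auto
  \<comment> \<open>First passage excludes staying below \<open>x\<close>, so a lower bound for the
    normal tail becomes an upper bound for \<open>prob N\<close>.\<close>
  also have "\<dots> \<le> prob (space M - N)"
  proof (intro finite_measure_mono)
    show "(\<Union>k<n. A k) \<subseteq> space M - N"
    proof
      fix \<omega> assume "\<omega> \<in> (\<Union>k<n. A k)"
      then obtain k where "k < n" "\<omega> \<in> space M" "\<not> B (t k) \<omega> < x" by (auto simp: A_def)
      then show "\<omega> \<in> space M - N" unfolding N_def using less_imp_le by blast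
    qed
  qed auto
  also have "\<dots> = 1 - prob N" by (intro prob_compl) auto
  finally have "2 * prob {\<omega>\<in>space M. x + \<epsilon> \<le> B T \<omega> - B 0 \<omega>} \<le> 2 * prob big + (1 - prob N)" by simp
  moreover have "1 - (x + \<epsilon>) / sqrt T \<le> 2 * prob {\<omega>\<in>space M. x + \<epsilon> \<le> B T \<omega> - B 0 \<omega>}"
    using brownian_motionD(6)[OF B, of 0 T] assms by (intro centered_normal_prob_ge) auto
  ultimately show ?thesis unfolding N_def big_def t_def by simp
qed

text \<open>Each path is uniformly continuous on \<open>{0..T}\<close>, so it has a step larger than
  \<open>\<epsilon>\<close> only for finitely many grid sizes.\<close>

lemma brownian_motion_small_steps:
  assumes B: "brownian_motion M B" and "0 < T" "0 < \<epsilon>" "0 < \<delta>"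
  obtains n where "0 < n"
    "measure M {\<omega>\<in>space M. \<exists>k<n. \<epsilon> < \<bar>B (real (Suc k) * T / real n) \<omega> - B (real k * T / real n) \<omega>\<bar>} < \<delta>"
proof -
  interpret prob_space M using brownian_motionD(1)[OF B] .
  define big where "big n = {\<omega>\<in>space M. \<exists>k<n. \<epsilon> < \<bar>B (real (Suc k) * T / real n) \<omega> - B (real k * T / real n) \<omega>\<bar>}" for n
  have [measurable]: "B (real k * T / real n) \<in> borel_measurable M" for k n
    using brownian_motionD(2)[OF B] assms by simp
  have [measurable]: "big n \<in> sets M" for n
    unfolding big_def by measurable
  \<comment> \<open>The events \<open>big n\<close> need not decrease in \<open>n\<close>; their
    tail unions do, which permits continuity from above.\<close>
  define F where "F N = (\<Union>n\<in>{N..}. big n)" for N :: nat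
  have "decseq F" unfolding F_def decseq_def by (intro allI impI UN_mono) auto
  have F: "F N \<in> sets M" for N unfolding F_def by (intro sets.countable_UN'') auto
  have "\<exists>N. \<omega> \<notin> F N" if \<omega>: "\<omega> \<in> space M" for \<omega>
  proof -
    have "uniformly_continuous_on {0..T} (\<lambda>t. B t \<omega>)"
      using continuous_on_subset[OF brownian_motionD(4)[OF B \<omega>]] by (intro compact_uniformly_continuous) auto
    then obtain d where d: "0 < d" "\<And>s s'. \<lbrakk>s \<in> {0..T}; s' \<in> {0..T}; dist s' s < d\<rbrakk> \<Longrightarrow> dist (B s' \<omega>) (B s \<omega>) < \<epsilon>"
      using \<open>0 < \<epsilon>\<close> unfolding uniformly_continuous_on_def by metis
    obtain N where N: "T / d < real N" using reals_Archimedean2 by blast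
    have "\<omega> \<notin> big n" if "N \<le> n" for n
    proof -
      have "0 < T / d" using assms d by simp
      then have n: "0 < real n" "T / d < real n" using N that by auto
      then have step: "T / real n < d" using d by (simp add: field_simps)
      have "\<bar>B (real (Suc k) * T / real n) \<omega> - B (real k * T / real n) \<omega>\<bar> < \<epsilon>" if "k < n" for k
      proof -
        have "real (Suc k) * T / real n - real k * T / real n = T / real n"
          using n by (simp add: field_simps)
        moreover have le_T: "real j * T / real n \<le> T" if "j \<le> n" for j
          using that n assms by (simp add: field_simps)
        ultimately show ?thesis
          using d(2)[of "real k * T / real n" "real (Suc k) * T / real n"] step that assms le_T[of k] le_T[of "Suc k"]
          by (simp add: dist_real_def del: of_nat_Suc)
      qed
      then show ?thesis by (force simp: big_def)
    qed
    then show ?thesis by (auto simp: F_def)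
  qed
  moreover have "F 0 \<subseteq> space M" by (auto simp: F_def big_def)
  ultimately have "(\<Inter>N. F N) = {}" by auto
  then have "(\<lambda>N. prob (F N)) \<longlonglongrightarrow> 0"
    using finite_Lim_measure_decseq[of F] F \<open>decseq F\<close> by auto
  then have "eventually (\<lambda>N. prob (F N) < \<delta>) sequentially"
    using \<open>0 < \<delta>\<close> by (intro order_tendstoD(2)) auto
  then obtain N where N: "prob (F N) < \<delta>" by (auto simp: eventually_sequentially)
  \<comment> \<open>\<open>Suc N\<close> rather than \<open>N\<close>, because the grid size must be
    positive.\<close>
  have "prob (big (Suc N)) \<le> prob (F N)"
    using F by (intro finite_measure_mono) (auto simp: F_def intro!: bexI[of _ "Suc N"])
  with N show thesis using that[of "Suc N"] by (simp add: big_def)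
qed

text \<open>Allowing an overshoot of \<open>x\<close> costs \<open>2 * x / sqrt T\<close>; the grid
  is then chosen so fine that the large steps contribute at most another
  \<open>x / sqrt T\<close>.\<close>

lemma brownian_motion_stays_below:
  assumes B: "brownian_motion M B" and "0 < T" "0 < x"
  obtains F where "finite F" "F \<subseteq> {0..T}" "measure M {\<omega>\<in>space M. \<forall>s\<in>F. B s \<omega> < x} \<le> 3 * x / sqrt T"
proof -
  obtain n where n: "0 < n"
    "measure M {\<omega>\<in>space M. \<exists>k<n. x < \<bar>B (real (Suc k) * T / real n) \<omega> - B (real k * T / real n) \<omega>\<bar>} < x / (2 * sqrt T)"
    using brownian_motion_small_steps[OF B \<open>0 < T\<close> \<open>0 < x\<close>, of "x / (2 * sqrt T)"] assms by auto
  define F where "F = (\<lambda>k. real k * T / real n) ` {..n}"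
  have eq: "{\<omega>\<in>space M. \<forall>s\<in>F. B s \<omega> < x} = {\<omega>\<in>space M. \<forall>k\<le>n. B (real k * T / real n) \<omega> < x}"
    by (auto simp: F_def)
  have "measure M {\<omega>\<in>space M. \<forall>s\<in>F. B s \<omega> < x} \<le> (x + x) / sqrt T + 2 * (x / (2 * sqrt T))"
    unfolding eq using brownian_motion_grid_reflection[OF B \<open>0 < T\<close> \<open>0 < n\<close> \<open>0 < x\<close> \<open>0 < x\<close>] n(2) by linarith
  also have "\<dots> = 3 * x / sqrt T" using assms by (simp add: field_simps)
  finally have "measure M {\<omega>\<in>space M. \<forall>s\<in>F. B s \<omega> < x} \<le> 3 * x / sqrt T" .
  moreover have "real k * T / real n \<le> T" if "k \<le> n" for k
    using that n(1) assms by (simp add: field_simps)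
  then have "F \<subseteq> {0..T}" using assms by (auto simp: F_def)
  ultimately show thesis using that[of F] by (simp add: F_def)
qed

section \<open>Boundary decay of the survival probability\<close>

lemma indep_BMsD:
  assumes "indep_BMs M Xp Xm Y"
  shows "brownian_motion M Xp" "brownian_motion M Xm" "brownian_motion M Y" "prob_space M"
  using assms unfolding indep_BMs_def brownian_motion_def by auto

text \<open>Conditions at finitely many coordinates are measurable in the product space of paths. As
  \<open>F\<close> and \<open>G\<close> contain only nonnegative times, they never see the value 0
  given to paths at negative times. The factors \<open>c\<close> and \<open>d\<close> serve as signs
  later, so that one statement covers bounds from above and below.\<close>

lemma indep_BMs_prob_below:
  assumes BM: "indep_BMs M Xp Xm Y"
    and ij: "i \<in> {0, 1, 2}" "j \<in> {0, 1, 2}" "i \<noteq> (j::nat)"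
    and F: "finite F" "F \<subseteq> {0..}" and G: "finite G" "G \<subseteq> {0..}"
  shows "measure M ({\<omega>\<in>space M. \<forall>s\<in>F. c * ([Xp, Xm, Y] ! i) s \<omega> < x} \<inter> {\<omega>\<in>space M. \<forall>s\<in>G. d * ([Xp, Xm, Y] ! j) s \<omega> < y})
    = measure M {\<omega>\<in>space M. \<forall>s\<in>F. c * ([Xp, Xm, Y] ! i) s \<omega> < x} *
      measure M {\<omega>\<in>space M. \<forall>s\<in>G. d * ([Xp, Xm, Y] ! j) s \<omega> < y}"
    (is "measure M (?A \<inter> ?B) = measure M ?A * measure M ?B")
proof -
  interpret prob_space M using indep_BMsD(4)[OF BM] .
  let ?P = "PiM UNIV (\<lambda>_::real. borel :: real measure)"
  define path where "path = (\<lambda>i \<omega> t. if t \<ge> 0 then ([Xp, Xm, Y] ! i) t \<omega> else 0)"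
  have ind: "indep_vars (\<lambda>_. ?P) path {0::nat, 1, 2}"
    using BM unfolding indep_BMs_def path_def by blast
  have below: "{v\<in>space ?P. \<forall>s\<in>F. c * v s < x} \<in> sets ?P" if "finite F" for F c x
    using that by (intro sets.sets_Collect_finite_All) measurable
  define S where "S k = (if k = i then {v\<in>space ?P. \<forall>s\<in>F. c * v s < x} else {v\<in>space ?P. \<forall>s\<in>G. d * v s < y})" for k
  have A: "path i -` S i \<inter> space M = ?A"
    using F by (auto simp: S_def path_def space_PiM)
  have B: "path j -` S j \<inter> space M = ?B"
    using G ij by (auto simp: S_def path_def space_PiM)
  have "prob (\<Inter>k\<in>{i, j}. path k -` S k \<inter> space M) = (\<Prod>k\<in>{i, j}. prob (path k -` S k \<inter> space M))"
    using ij F G below by (intro indep_varsD[OF ind]) (auto simp: S_def)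
  then show ?thesis using ij(3) unfolding A[symmetric] B[symmetric] by simp
qed

lemma brownian_motion_stays_below_signed:
  assumes B: "brownian_motion M B" and "0 < T" "0 < x" and c: "c \<in> {1, -1}"
  obtains F where "finite F" "F \<subseteq> {0..T}" "measure M {\<omega>\<in>space M. \<forall>s\<in>F. c * B s \<omega> < x} \<le> 3 * x / sqrt T"
proof (cases "c = 1")
  case True
  show ?thesis
    by (rule brownian_motion_stays_below[OF B \<open>0 < T\<close> \<open>0 < x\<close>]) (rule that, simp_all add: True)
next
  case False
  then have "c = -1" using c by simp
  show ?thesis
    by (rule brownian_motion_stays_below[OF brownian_motion_uminus[OF B] \<open>0 < T\<close> \<open>0 < x\<close>])
      (rule that, simp_all add: \<open>c = -1\<close>)
qed

text \<open>The exponent 2 comes from two independent increments, over the two halves of the time interval.\<close>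

lemma brownian_motion_two_times_small:
  assumes B: "brownian_motion M B" and "0 < t" "0 < h"
  shows "measure M {\<omega>\<in>space M. \<bar>B (t/2) \<omega>\<bar> < h \<and> \<bar>B t \<omega>\<bar> < h} \<le> 4 * h\<^sup>2 / t"
proof -
  interpret prob_space M using brownian_motionD(1)[OF B] .
  define ts where "ts i = real i * t / 2" for i :: nat
  define X where "X i \<omega> = B (ts (Suc i)) \<omega> - B (ts i) \<omega>" for i \<omega>
  have meas [measurable]: "B t \<in> borel_measurable M" "B (t/2) \<in> borel_measurable M"
    using brownian_motionD(2)[OF B] assms by simp_all
  have zero: "B 0 \<omega> = 0" if "\<omega> \<in> space M" for \<omega> using brownian_motionD(3)[OF B that] .
  have ind: "indep_vars (\<lambda>_. borel) X {..<2::nat}"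
    unfolding X_def using assms by (intro brownian_motionD(5)[OF B]) (auto simp: ts_def)
  have X: "X 0 \<omega> = B (t/2) \<omega>" "X 1 \<omega> = B t \<omega> - B (t/2) \<omega>" if "\<omega> \<in> space M" for \<omega>
    using zero[OF that] by (simp_all add: X_def ts_def)
  \<comment> \<open>Two values within \<open>h\<close> of 0 differ by less than
    \<open>2 * h\<close>, hence the wider window for the second increment.\<close>
  define S where "S i = (if i = (0::nat) then {-h<..<h} else {-2*h<..<2*h})" for i
  have pre: "X 0 -` S 0 \<inter> space M = {\<omega>\<in>space M. \<bar>X 0 \<omega>\<bar> < h}"
      "X 1 -` S 1 \<inter> space M = {\<omega>\<in>space M. \<bar>X 1 \<omega>\<bar> < 2 * h}"
    by (auto simp: S_def abs_less_iff)
  have dist: "distributed M lborel (X i) (\<lambda>y. ennreal (normal_density 0 (sqrt (t/2)) y))" for i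
    using brownian_motionD(6)[OF B, of "ts i" "ts (Suc i)"] \<open>0 < t\<close> unfolding X_def
    by (simp add: ts_def field_simps)
  have "{\<omega>\<in>space M. \<bar>B (t/2) \<omega>\<bar> < h \<and> \<bar>B t \<omega>\<bar> < h} \<subseteq> (\<Inter>i\<in>{0, 1}. X i -` S i \<inter> space M)"
    using X by (auto simp: S_def)
  moreover have "X i \<in> borel_measurable M" for i using dist[of i] by (auto simp: distributed_def)
  ultimately have "prob {\<omega>\<in>space M. \<bar>B (t/2) \<omega>\<bar> < h \<and> \<bar>B t \<omega>\<bar> < h} \<le> prob (\<Inter>i\<in>{0, 1}. X i -` S i \<inter> space M)"
    by (intro finite_measure_mono sets.finite_INT) (auto intro!: measurable_sets[of _ M borel] simp: S_def)
  also have "\<dots> = (\<Prod>i\<in>{0, 1}. prob (X i -` S i \<inter> space M))"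
    by (intro indep_varsD[OF ind]) (auto simp: S_def)
  also have "\<dots> = prob {\<omega>\<in>space M. \<bar>X 0 \<omega>\<bar> < h} * prob {\<omega>\<in>space M. \<bar>X 1 \<omega>\<bar> < 2 * h}"
    using pre by simp
  also have "\<dots> \<le> h / sqrt (t/2) * (2 * h / sqrt (t/2))"
    using dist assms by (intro mult_mono centered_normal_prob_abs_less) auto
  also have "\<dots> = 4 * h\<^sup>2 / t"
    using assms by (simp add: power2_eq_square)
  finally show ?thesis .
qed

lemma brownian_motion_below_sets:
  assumes B: "brownian_motion M B" and F: "finite F" "F \<subseteq> {0..}"
  shows "{\<omega>\<in>space M. \<forall>s\<in>F. d * B s \<omega> < y} \<in> sets M"
proof -
  have "B s \<in> borel_measurable M" if "s \<in> F" for s using brownian_motionD(2)[OF B] that F by auto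
  then show ?thesis
    using F by (intro sets.sets_Collect_finite_All borel_measurable_less borel_measurable_times
        borel_measurable_const) auto
qed

text \<open>If \<open>Y\<close> reaches \<open>h\<close> by time \<open>t\<close>, it takes every
  value in \<open>{0..h}\<close> on the way, so the constraint on the composed path reaches all of
  \<open>Xp\<close> on \<open>{0..h}\<close>; likewise \<open>-h\<close> and \<open>Xm\<close>. So
  on \<open>E\<close> one of \<open>Up\<close>, \<open>Ap\<close> and one of \<open>Um\<close>,
  \<open>Am\<close> must occur, which leaves four intersections. The sign \<open>c\<close> selects
  the endpoint of the interval.\<close>

lemma ibm_stays_below_prob_le:
  assumes BM: "indep_BMs M Xp Xm Y" and c: "c \<in> {1, -1}" and pos: "0 < t" "0 < x" "0 < h"
    and E: "E \<subseteq> space M" "\<And>\<omega> s. \<lbrakk>\<omega> \<in> E; s \<in> {0..t}\<rbrakk> \<Longrightarrow> c * two_sided Xp Xm (Y s \<omega>) \<omega> < x"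
  shows "measure M E \<le> (3 * x / sqrt h)\<^sup>2 + 2 * (3 * h / sqrt t * (3 * x / sqrt h)) + 4 * h\<^sup>2 / t"
proof -
  note Xp = indep_BMsD(1)[OF BM] and Xm = indep_BMsD(2)[OF BM] and Y = indep_BMsD(3)[OF BM]
  interpret prob_space M using indep_BMsD(4)[OF BM] .
  obtain Fp where Fp: "finite Fp" "Fp \<subseteq> {0..h}" "prob {\<omega>\<in>space M. \<forall>s\<in>Fp. c * Xp s \<omega> < x} \<le> 3 * x / sqrt h"
    using brownian_motion_stays_below_signed[OF Xp \<open>0 < h\<close> \<open>0 < x\<close> c] .
  obtain Fm where Fm: "finite Fm" "Fm \<subseteq> {0..h}" "prob {\<omega>\<in>space M. \<forall>s\<in>Fm. c * Xm s \<omega> < x} \<le> 3 * x / sqrt h"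
    using brownian_motion_stays_below_signed[OF Xm \<open>0 < h\<close> \<open>0 < x\<close> c] .
  \<comment> \<open>Adding the times \<open>t/2\<close> and \<open>t\<close> only shrinks the event,
    and later lets \<open>Up \<inter> Um\<close> confine \<open>Y\<close> at both times.\<close>
  have "\<exists>G. finite G \<and> G \<subseteq> {0..t} \<and> {t/2, t} \<subseteq> G \<and> prob {\<omega>\<in>space M. \<forall>s\<in>G. d * Y s \<omega> < h} \<le> 3 * h / sqrt t"
    if d: "d \<in> {1, -1}" for d
  proof -
    obtain G where G: "finite G" "G \<subseteq> {0..t}" "prob {\<omega>\<in>space M. \<forall>s\<in>G. d * Y s \<omega> < h} \<le> 3 * h / sqrt t"
      using brownian_motion_stays_below_signed[OF Y \<open>0 < t\<close> \<open>0 < h\<close> d] .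
    have "{\<omega>\<in>space M. \<forall>s\<in>G. d * Y s \<omega> < h} \<in> sets M"
      using G by (intro brownian_motion_below_sets[OF Y]) auto
    then have "prob {\<omega>\<in>space M. \<forall>s\<in>G \<union> {t/2, t}. d * Y s \<omega> < h} \<le> prob {\<omega>\<in>space M. \<forall>s\<in>G. d * Y s \<omega> < h}"
      by (intro finite_measure_mono) auto
    then show ?thesis using G pos by (intro exI[of _ "G \<union> {t/2, t}"]) auto
  qed
  from this[of 1] this[of "-1"] obtain Gp Gm
    where Gp: "finite Gp" "Gp \<subseteq> {0..t}" "{t/2, t} \<subseteq> Gp" "prob {\<omega>\<in>space M. \<forall>s\<in>Gp. 1 * Y s \<omega> < h} \<le> 3 * h / sqrt t"
      and Gm: "finite Gm" "Gm \<subseteq> {0..t}" "{t/2, t} \<subseteq> Gm" "prob {\<omega>\<in>space M. \<forall>s\<in>Gm. - 1 * Y s \<omega> < h} \<le> 3 * h / sqrt t"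
    by auto
  define Ap where "Ap = {\<omega>\<in>space M. \<forall>s\<in>Fp. c * Xp s \<omega> < x}"
  define Am where "Am = {\<omega>\<in>space M. \<forall>s\<in>Fm. c * Xm s \<omega> < x}"
  define Up where "Up = {\<omega>\<in>space M. \<forall>s\<in>Gp. 1 * Y s \<omega> < h}"
  define Um where "Um = {\<omega>\<in>space M. \<forall>s\<in>Gm. - 1 * Y s \<omega> < h}"
  have nonneg: "Fp \<subseteq> {0..}" "Fm \<subseteq> {0..}" "Gp \<subseteq> {0..}" "Gm \<subseteq> {0..}"
    using Fp(2) Fm(2) Gp(2) Gm(2) by auto
  have meas: "Ap \<in> sets M" "Am \<in> sets M" "Up \<in> sets M" "Um \<in> sets M"
    unfolding Ap_def Am_def Up_def Um_def using Xp Xm Y Fp(1) Fm(1) Gp(1) Gm(1) nonneg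
    by (simp_all only: brownian_motion_below_sets)
  have reach: "\<exists>s'\<in>{0..t}. d * Y s' \<omega> = r"
    if r: "\<omega> \<in> space M" "s \<in> {0..t}" "h \<le> d * Y s \<omega>" "r \<in> {0..h}" for \<omega> s r d
  proof -
    have "continuous_on {0..s} (\<lambda>s. d * Y s \<omega>)"
      using continuous_on_subset[OF brownian_motionD(4)[OF Y \<open>\<omega> \<in> space M\<close>], of "{0..s}"]
      by (intro continuous_intros) auto
    then obtain s' where "0 \<le> s'" "s' \<le> s" "d * Y s' \<omega> = r"
      using IVT'[of "\<lambda>s. d * Y s \<omega>" 0 r s] r brownian_motionD(3)[OF Y \<open>\<omega> \<in> space M\<close>] by auto
    then show ?thesis using r by (intro bexI[of _ s']) auto
  qed
  have "E \<subseteq> (Ap \<inter> Am) \<union> (Up \<inter> Am) \<union> (Um \<inter> Ap) \<union> (Up \<inter> Um)"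
  proof
    fix \<omega> assume "\<omega> \<in> E"
    then have \<omega>: "\<omega> \<in> space M" and stay: "\<And>s. s \<in> {0..t} \<Longrightarrow> c * two_sided Xp Xm (Y s \<omega>) \<omega> < x"
      using E by auto
    have "\<omega> \<in> Ap" if not_Up: "\<omega> \<notin> Up"
    proof -
      obtain s where s: "s \<in> {0..t}" "h \<le> 1 * Y s \<omega>"
        using not_Up \<omega> Gp(2) by (auto simp: Up_def not_less)
      have "c * Xp r \<omega> < x" if "r \<in> {0..h}" for r
      proof -
        obtain s' where "s' \<in> {0..t}" "1 * Y s' \<omega> = r" using reach[OF \<omega> s \<open>r \<in> {0..h}\<close>] by auto
        then show ?thesis using stay[of s'] that by (simp add: two_sided_def)
      qed
      then show ?thesis using Fp(2) \<omega> by (auto simp: Ap_def)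
    qed
    moreover have "\<omega> \<in> Am" if not_Um: "\<omega> \<notin> Um"
    proof -
      obtain s where s: "s \<in> {0..t}" "h \<le> - 1 * Y s \<omega>"
        using not_Um \<omega> Gm(2) by (auto simp: Um_def not_less)
      have "c * Xm r \<omega> < x" if "r \<in> {0..h}" for r
      \<comment> \<open>At 0 the two-sided path is read from \<open>Xp\<close>, so the bound for
        \<open>Xm\<close> there comes from its starting value.\<close>
      proof (cases "r = 0")
        case True
        then show ?thesis using brownian_motionD(3)[OF Xm \<omega>] pos by simp
      next
        case False
        obtain s' where "s' \<in> {0..t}" "- 1 * Y s' \<omega> = r" using reach[OF \<omega> s \<open>r \<in> {0..h}\<close>] by auto
        then have "Y s' \<omega> = - r" "s' \<in> {0..t}" by auto
        then show ?thesis using stay[of s'] that False by (simp add: two_sided_def)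
      qed
      then show ?thesis using Fm(2) \<omega> by (auto simp: Am_def)
    qed
    ultimately show "\<omega> \<in> (Ap \<inter> Am) \<union> (Up \<inter> Am) \<union> (Um \<inter> Ap) \<union> (Up \<inter> Um)" by blast
  qed
  then have "prob E \<le> prob ((Ap \<inter> Am) \<union> (Up \<inter> Am) \<union> (Um \<inter> Ap) \<union> (Up \<inter> Um))"
    using meas by (intro finite_measure_mono) auto
  also have "\<dots> \<le> prob (Ap \<inter> Am) + prob (Up \<inter> Am) + prob (Um \<inter> Ap) + prob (Up \<inter> Um)"
    using meas by (intro order.trans[OF measure_Un_le] add_right_mono order.refl) auto
  also have "prob (Ap \<inter> Am) = prob Ap * prob Am"
    using indep_BMs_prob_below[OF BM, of 0 1 Fp Fm c x c x] Fp Fm nonneg by (simp add: Ap_def Am_def)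
  also have "prob (Up \<inter> Am) = prob Up * prob Am"
    using indep_BMs_prob_below[OF BM, of 2 1 Gp Fm 1 h c x] Gp Fm nonneg by (simp add: Up_def Am_def)
  also have "prob (Um \<inter> Ap) = prob Um * prob Ap"
    using indep_BMs_prob_below[OF BM, of 2 0 Gm Fp "-1" h c x] Gm Fp nonneg by (simp add: Um_def Ap_def)
  \<comment> \<open>Both events concern \<open>Y\<close>, so independence of the processes does not
    apply; the second power of \<open>h\<close> comes from the two increments of \<open>Y\<close>
    instead.\<close>
  also have "prob (Up \<inter> Um) \<le> 4 * h\<^sup>2 / t"
  proof -
    have [measurable]: "Y t \<in> borel_measurable M" "Y (t/2) \<in> borel_measurable M"
      using brownian_motionD(2)[OF Y] pos by simp_all
    have "prob (Up \<inter> Um) \<le> prob {\<omega>\<in>space M. \<bar>Y (t/2) \<omega>\<bar> < h \<and> \<bar>Y t \<omega>\<bar> < h}"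
    proof (intro finite_measure_mono)
      show "Up \<inter> Um \<subseteq> {\<omega>\<in>space M. \<bar>Y (t/2) \<omega>\<bar> < h \<and> \<bar>Y t \<omega>\<bar> < h}"
        using Gp(3) Gm(3) by (auto simp: Up_def Um_def abs_less_iff)
    qed measurable
    also have "\<dots> \<le> 4 * h\<^sup>2 / t" using brownian_motion_two_times_small[OF Y] pos by simp
    finally show ?thesis .
  qed
  also have "prob Ap * prob Am + prob Up * prob Am + prob Um * prob Ap + 4 * h\<^sup>2 / t
      \<le> 3 * x / sqrt h * (3 * x / sqrt h) + 3 * h / sqrt t * (3 * x / sqrt h) + 3 * h / sqrt t * (3 * x / sqrt h) + 4 * h\<^sup>2 / t"
    using Fp(3) Fm(3) Gp(4) Gm(4) pos unfolding Ap_def Am_def Up_def Um_def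
    by (intro add_mono mult_mono) auto
  also have "\<dots> = (3 * x / sqrt h)\<^sup>2 + 2 * (3 * h / sqrt t * (3 * x / sqrt h)) + 4 * h\<^sup>2 / t"
    by (simp only: power2_eq_square)
  finally show ?thesis by simp
qed

text \<open>With \<open>x = y\<^sup>3\<close> the choice \<open>h = y\<^sup>2\<close> balances the three terms.\<close>

lemma ibm_stays_below_prob_le_power4:
  assumes BM: "indep_BMs M Xp Xm Y" and c: "c \<in> {1, -1}" and pos: "0 < t" "0 < y"
    and E: "E \<subseteq> space M" "\<And>\<omega> s. \<lbrakk>\<omega> \<in> E; s \<in> {0..t}\<rbrakk> \<Longrightarrow> c * two_sided Xp Xm (Y s \<omega>) \<omega> < y ^ 3"
  shows "measure M E \<le> (9 + 18 / sqrt t + 4 / t) * y ^ 4"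
proof -
  have "measure M E \<le> (3 * y ^ 3 / sqrt (y\<^sup>2))\<^sup>2 + 2 * (3 * y\<^sup>2 / sqrt t * (3 * y ^ 3 / sqrt (y\<^sup>2))) + 4 * (y\<^sup>2)\<^sup>2 / t"
    using E pos by (intro ibm_stays_below_prob_le[OF BM c]) auto
  also have "3 * y ^ 3 / sqrt (y\<^sup>2) = 3 * y\<^sup>2"
    using pos by (simp add: power3_eq_cube power2_eq_square)
  also have "(3 * y\<^sup>2)\<^sup>2 + 2 * (3 * y\<^sup>2 / sqrt t * (3 * y\<^sup>2)) + 4 * (y\<^sup>2)\<^sup>2 / t = (9 + 18 / sqrt t + 4 / t) * y ^ 4"
    by (simp add: algebra_simps power2_eq_square power4_eq_xxxx)
  finally show ?thesis .
qed

section \<open>Survival events of iterated Brownian motion\<close>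

lemma ibm_initial:
  assumes BM: "indep_BMs M Xp Xm Y" and \<omega>: "\<omega> \<in> space M"
  shows "ibm Xp Xm Y x 0 \<omega> = x"
  using brownian_motionD(3)[OF indep_BMsD(1)[OF BM] \<omega>] brownian_motionD(3)[OF indep_BMsD(3)[OF BM] \<omega>]
  by (simp add: ibm_def two_sided_def)

lemma continuous_on_two_sided:
  assumes "indep_BMs M Xp Xm Y" "\<omega> \<in> space M"
  shows "continuous_on UNIV (\<lambda>s. two_sided Xp Xm s \<omega>)"
proof -
  note Xp = indep_BMsD(1)[OF assms(1)] and Xm = indep_BMsD(2)[OF assms(1)]
  have "continuous_on {0..} (\<lambda>s. Xp s \<omega>)" using brownian_motionD(4)[OF Xp assms(2)] .
  moreover have "continuous_on {..0} (\<lambda>s. Xm (- s) \<omega>)"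
    by (rule continuous_on_compose2[OF brownian_motionD(4)[OF Xm assms(2)]]) (auto intro!: continuous_intros)
  ultimately have "continuous_on ({0..} \<union> {..0}) (\<lambda>s. if 0 \<le> s then Xp s \<omega> else Xm (- s) \<omega>)"
    using brownian_motionD(3)[OF Xp assms(2)] brownian_motionD(3)[OF Xm assms(2)]
    by (intro continuous_on_cases) auto
  moreover have "{0..} \<union> {..0::real} = UNIV" by auto
  ultimately show ?thesis unfolding two_sided_def by simp
qed

lemma continuous_on_ibm:
  assumes "indep_BMs M Xp Xm Y" "\<omega> \<in> space M"
  shows "continuous_on {0..} (\<lambda>t. ibm Xp Xm Y x t \<omega>)"
proof -
  have "continuous_on {0..} (\<lambda>t. two_sided Xp Xm (Y t \<omega>) \<omega>)"
    by (rule continuous_on_compose2[OF continuous_on_two_sided[OF assms]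
        brownian_motionD(4)[OF indep_BMsD(3)[OF assms(1)] assms(2)]]) auto
  then show ?thesis unfolding ibm_def by (intro continuous_on_add continuous_on_const)
qed

text \<open>Composition with the random time \<open>Y t\<close> is measurable because it is a limit of compositions with
  the discretised times \<open>\<lfloor>n Y t\<rfloor> / n\<close>.\<close>

lemma ibm_measurable:
  assumes BM: "indep_BMs M Xp Xm Y" and "0 \<le> t"
  shows "ibm Xp Xm Y x t \<in> borel_measurable M"
proof -
  have [measurable]: "Y t \<in> borel_measurable M"
    using brownian_motionD(2)[OF indep_BMsD(3)[OF BM]] assms by simp
  have [measurable]: "two_sided Xp Xm q \<in> borel_measurable M" for q
    using brownian_motionD(2)[OF indep_BMsD(1)[OF BM], of q] brownian_motionD(2)[OF indep_BMsD(2)[OF BM], of "-q"]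
    by (cases "0 \<le> q") (simp_all add: two_sided_def[abs_def])
  define r where "r n \<omega> = real_of_int \<lfloor>real (Suc n) * Y t \<omega>\<rfloor> / real (Suc n)" for n \<omega>
  have "(\<lambda>\<omega>. two_sided Xp Xm (r n \<omega>) \<omega>) \<in> borel_measurable M" for n
  proof -
    have "(\<lambda>\<omega>. (\<lambda>k::int. two_sided Xp Xm (real_of_int k / real (Suc n))) \<lfloor>real (Suc n) * Y t \<omega>\<rfloor> \<omega>) \<in> borel_measurable M"
      by (rule measurable_compose_countable) measurable
    then show ?thesis by (simp add: r_def)
  qed
  moreover have "(\<lambda>n. two_sided Xp Xm (r n \<omega>) \<omega>) \<longlonglongrightarrow> two_sided Xp Xm (Y t \<omega>) \<omega>" if \<omega>: "\<omega> \<in> space M" for \<omega>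
  proof -
    have "norm (r n \<omega> - Y t \<omega>) \<le> inverse (real (Suc n))" for n
    proof -
      have "r n \<omega> - Y t \<omega> = (real_of_int \<lfloor>real (Suc n) * Y t \<omega>\<rfloor> - real (Suc n) * Y t \<omega>) / real (Suc n)"
        by (simp add: r_def diff_divide_distrib)
      also have "norm \<dots> \<le> 1 / real (Suc n)"
        unfolding norm_divide by (intro frac_le) (auto simp: abs_if, linarith+)
      finally show ?thesis by (simp add: inverse_eq_divide)
    qed
    then have "(\<lambda>n. r n \<omega> - Y t \<omega>) \<longlonglongrightarrow> 0"
      by (intro Lim_null_comparison[OF _ LIMSEQ_inverse_real_of_nat]) auto
    then have "(\<lambda>n. r n \<omega>) \<longlonglongrightarrow> Y t \<omega>" by (rule LIM_zero_cancel)
    then show ?thesis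
      using continuous_on_tendsto_compose[OF continuous_on_two_sided[OF BM \<omega>]] by simp
  qed
  ultimately have [measurable]: "(\<lambda>\<omega>. two_sided Xp Xm (Y t \<omega>) \<omega>) \<in> borel_measurable M"
    by (rule borel_measurable_LIMSEQ_real[rotated])
  show ?thesis unfolding ibm_def[abs_def] by measurable
qed

text \<open>The set of times outside \<open>D\<close> is closed, so its infimum is attained when it
  is nonempty. This makes the inequality strict although the time interval is closed.\<close>

lemma less_exit_time_iff:
  assumes cont: "continuous_on {0..} (\<lambda>s. Z s \<omega>)" and D: "open D"
  shows "ereal t < exit_time D Z \<omega> \<longleftrightarrow> (\<forall>s\<in>{0..t}. Z s \<omega> \<in> D)"
proof
  assume less: "ereal t < exit_time D Z \<omega>"
  show "\<forall>s\<in>{0..t}. Z s \<omega> \<in> D"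
  proof (rule ccontr)
    assume "\<not> ?thesis"
    then obtain s where s: "s \<in> {0..t}" "Z s \<omega> \<notin> D" by auto
    then have "exit_time D Z \<omega> \<le> ereal s" unfolding exit_time_def by (intro Inf_lower) auto
    also have "\<dots> \<le> ereal t" using s by simp
    finally show False using less by simp
  qed
next
  assume inside: "\<forall>s\<in>{0..t}. Z s \<omega> \<in> D"
  define C where "C = {s. 0 \<le> s \<and> Z s \<omega> \<notin> D}"
  show "ereal t < exit_time D Z \<omega>"
  proof (cases "C = {}")
    case True
    then show ?thesis unfolding exit_time_def C_def[symmetric] by (simp add: top_ereal_def)
  next
    case False
    have "C = {0..} \<inter> (\<lambda>s. Z s \<omega>) -` (- D)" by (auto simp: C_def)
    then have "closed C" using continuous_on_closed_vimage[of "{0..}" "\<lambda>s. Z s \<omega>"] cont D by (auto simp: Int_commute)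
    have bdd: "bdd_below C" by (auto simp: C_def intro!: bdd_belowI[of _ 0])
    have "Inf C \<in> C" using closed_contains_Inf False bdd \<open>closed C\<close> by blast
    then have "t < Inf C" using inside by (force simp: C_def)
    also have "ereal (Inf C) \<le> exit_time D Z \<omega>"
      unfolding exit_time_def C_def[symmetric] by (auto intro!: Inf_greatest cInf_lower bdd)
    finally show ?thesis by simp
  qed
qed

lemma survival_event_eq:
  assumes BM: "indep_BMs M Xp Xm Y"
  shows "{\<omega>\<in>space M. ereal t < exit_time {0<..<1} (ibm Xp Xm Y x) \<omega>}
    = {\<omega>\<in>space M. \<forall>s\<in>{0..t}. ibm Xp Xm Y x s \<omega> \<in> {0<..<1}}"
  by (intro Collect_cong conj_cong refl less_exit_time_iff continuous_on_ibm[OF BM]) auto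

text \<open>Positive distance to the boundary at every rational time would not suffice, since a path
  could touch the boundary at an irrational time. By compactness a surviving path keeps a uniform
  distance \<open>1 / real (Suc n)\<close>, a closed condition that passes from rational times to
  all of \<open>{0..t}\<close>.\<close>

lemma survival_event_sets:
  assumes BM: "indep_BMs M Xp Xm Y" and "0 < t"
  shows "{\<omega>\<in>space M. \<forall>s\<in>{0..t}. ibm Xp Xm Y x s \<omega> \<in> {0<..<1}} \<in> sets M"
proof -
  define Z where "Z = ibm Xp Xm Y x"
  define \<psi> where "\<psi> s \<omega> = min (Z s \<omega>) (1 - Z s \<omega>)" for s \<omega>
  define Q where "Q = {0..t} \<inter> \<rat>"
  have closure_Q: "closure Q = {0..t}"
    unfolding Q_def using closure_convex_Int_superset[of "{0..t}" \<rat>] \<open>0 < t\<close> by (simp add: Rats_closure_real)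
  have "countable Q" unfolding Q_def by (simp add: countable_Int2 countable_rat)
  have [measurable]: "\<psi> s \<in> borel_measurable M" if "s \<in> Q" for s
  proof -
    have [measurable]: "Z s \<in> borel_measurable M" unfolding Z_def using that by (intro ibm_measurable[OF BM]) (auto simp: Q_def)
    show ?thesis unfolding \<psi>_def[abs_def] by measurable
  qed
  have "(\<forall>s\<in>{0..t}. Z s \<omega> \<in> {0<..<1}) \<longleftrightarrow> (\<exists>n. \<forall>s\<in>Q. 1 / real (Suc n) \<le> \<psi> s \<omega>)" if \<omega>: "\<omega> \<in> space M" for \<omega>
  proof -
    have cont: "continuous_on {0..t} (\<lambda>s. \<psi> s \<omega>)"
      unfolding \<psi>_def Z_def using continuous_on_subset[OF continuous_on_ibm[OF BM \<omega>], of "{0..t}"]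
      by (intro continuous_intros) auto
    have "\<exists>n. \<forall>s\<in>Q. 1 / real (Suc n) \<le> \<psi> s \<omega>" if inside: "\<forall>s\<in>{0..t}. 0 < \<psi> s \<omega>"
    proof -
      obtain s0 where s0: "s0 \<in> {0..t}" "\<forall>s\<in>{0..t}. \<psi> s0 \<omega> \<le> \<psi> s \<omega>"
        using continuous_attains_inf[OF _ _ cont] \<open>0 < t\<close> by auto
      obtain n where "inverse (real (Suc n)) < \<psi> s0 \<omega>"
        using reals_Archimedean inside s0 by blast
      then show ?thesis using s0 unfolding Q_def by (intro exI[of _ n]) (force simp: inverse_eq_divide)
    qed
    moreover have "0 < \<psi> s \<omega>" if n: "\<forall>s\<in>Q. 1 / real (Suc n) \<le> \<psi> s \<omega>" and s: "s \<in> {0..t}" for n s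
    proof -
      have "0 < 1 / real (Suc n)" by simp
      also have "\<dots> \<le> \<psi> s \<omega>"
        by (rule continuous_ge_on_closure[of Q "\<lambda>s. \<psi> s \<omega>"]) (use cont n s closure_Q in auto)
      finally show ?thesis .
    qed
    moreover have "Z s \<omega> \<in> {0<..<1} \<longleftrightarrow> 0 < \<psi> s \<omega>" for s by (auto simp: \<psi>_def)
    ultimately show ?thesis by blast
  qed
  then have "{\<omega>\<in>space M. \<forall>s\<in>{0..t}. Z s \<omega> \<in> {0<..<1}} = {\<omega>\<in>space M. \<exists>n. \<forall>s\<in>Q. 1 / real (Suc n) \<le> \<psi> s \<omega>}"
    by blast
  also have "\<dots> \<in> sets M"
    using \<open>countable Q\<close> by (intro sets.sets_Collect_countable_Ex sets.sets_Collect_countable_All'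
        borel_measurable_le borel_measurable_const) auto
  finally show ?thesis unfolding Z_def .
qed

text \<open>Every path starts at \<open>x\<close> and survives some interval
  \<open>{0..inverse (real (Suc n))}\<close>. These countably many events cover the space, so they
  cannot all be null.\<close>

lemma survival_prob_positive:
  assumes BM: "indep_BMs M Xp Xm Y" and x: "0 < x" "x < 1"
  obtains t where "0 < t" "0 < measure M {\<omega>\<in>space M. \<forall>s\<in>{0..t}. ibm Xp Xm Y x s \<omega> \<in> {0<..<1}}"
proof (rule ccontr)
  assume no: "\<not> thesis"
  interpret prob_space M using indep_BMsD(4)[OF BM] .
  define S where "S n = {\<omega>\<in>space M. \<forall>s\<in>{0..inverse (real (Suc n))}. ibm Xp Xm Y x s \<omega> \<in> {0<..<1}}" for n
  have S: "S n \<in> sets M" for n unfolding S_def by (intro survival_event_sets[OF BM]) simp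
  have "prob (S n) = 0" for n
  proof (rule ccontr)
    assume "prob (S n) \<noteq> 0"
    then have "0 < prob (S n)" by (simp add: less_le)
    with no that[of "inverse (real (Suc n))"] show False by (simp add: S_def)
  qed
  then have "S n \<in> null_sets M" for n using S by (simp add: null_sets_def emeasure_eq_measure)
  then have "(\<Union>n. S n) \<in> null_sets M" by auto
  moreover have "space M \<subseteq> (\<Union>n. S n)"
  proof
    fix \<omega> assume \<omega>: "\<omega> \<in> space M"
    have "\<exists>d>0. \<forall>s\<in>{0..}. dist s 0 < d \<longrightarrow> dist (ibm Xp Xm Y x s \<omega>) (ibm Xp Xm Y x 0 \<omega>) < min x (1 - x)"
      using continuous_on_ibm[OF BM \<omega>, of x, unfolded continuous_on_iff, rule_format, of 0 "min x (1 - x)"] x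
      by simp
    then obtain d where d: "0 < d" "\<And>s. \<lbrakk>0 \<le> s; s < d\<rbrakk> \<Longrightarrow> \<bar>ibm Xp Xm Y x s \<omega> - x\<bar> < min x (1 - x)"
      unfolding ibm_initial[OF BM \<omega>] by (auto simp: dist_real_def)
    obtain n where n: "inverse (real (Suc n)) < d" using reals_Archimedean d by blast
    have "ibm Xp Xm Y x s \<omega> \<in> {0<..<1}" if "s \<in> {0..inverse (real (Suc n))}" for s
      using d(2)[of s] that n by (auto simp: abs_less_iff)
    then have "\<omega> \<in> S n" using \<omega> by (simp add: S_def)
    then show "\<omega> \<in> (\<Union>n. S n)" by blast
  qed
  ultimately have "space M \<in> null_sets M" by (metis null_sets_subset sets.top)
  then show False using emeasure_space_1 by (simp add: null_sets_def)
qed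

section \<open>From the boundary estimate to the contradiction\<close>

text \<open>The substitution \<open>x = y ^ 3\<close> avoids fractional powers: the quotient is at
  most \<open>K * y\<close>, that is, \<open>K * root 3 x\<close>.\<close>

lemma tendsto_quotient_zero_if_power4_bound:
  fixes f :: "real \<Rightarrow> real"
  assumes nonneg: "\<And>x. 0 < x \<Longrightarrow> 0 \<le> f x" and bound: "\<And>y. 0 < y \<Longrightarrow> f (y ^ 3) \<le> K * y ^ 4"
  shows "((\<lambda>x. f x / x) \<longlongrightarrow> 0) (at_right 0)"
proof (rule tendsto_sandwich)
  show "eventually (\<lambda>x. 0 \<le> f x / x) (at_right 0)"
    using eventually_at_right_less by eventually_elim (auto intro: divide_nonneg_pos nonneg)
  show "eventually (\<lambda>x. f x / x \<le> K * root 3 x) (at_right 0)"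
    using eventually_at_right_less
  proof eventually_elim
    case (elim x)
    define y where "y = root 3 x"
    have y: "0 < y" "x = y ^ 3" using elim by (simp_all add: y_def)
    have "f x / x \<le> K * y ^ 4 / y ^ 3"
      using bound[of y] y by (simp add: divide_right_mono)
    also have "\<dots> = K * y" using y by (simp add: power_eq_if)
    finally show ?case by (simp add: y_def)
  qed
  have "((\<lambda>x. K * root 3 x) \<longlongrightarrow> K * root 3 0) (at_right 0)"
    by (intro tendsto_intros)
  then show "((\<lambda>x. K * root 3 x) \<longlongrightarrow> 0) (at_right 0)" by simp
qed simp

theorem theorem1p2:
  fixes M :: "'a measure" and Xp Xm Y :: "real \<Rightarrow> 'a \<Rightarrow> real"
    and g :: "real \<Rightarrow> real \<Rightarrow> real" and a :: real
  assumes "indep_BMs M Xp Xm Y"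
    and "\<And>t x. g t x = measure M {\<omega> \<in> space M. ereal t < exit_time {0<..<1} (ibm Xp Xm Y x) \<omega>}"
    and "a > 0"
  shows "\<not> (\<forall>t>0. \<exists>f1 f2 f3 f4 :: real \<Rightarrow> real. \<forall>x\<in>{0<..<1}.
             ((\<lambda>y. g t y) has_real_derivative f1 x) (at x) \<and>
             (f1 has_real_derivative f2 x) (at x) \<and>
             (f2 has_real_derivative f3 x) (at x) \<and>
             (f3 has_real_derivative f4 x) (at x) \<and>
             ((\<lambda>s. g s x) has_real_derivative (a * f4 x)) (at t))"
proof
  note BM = assms(1)
  interpret prob_space M using indep_BMsD(4)[OF BM] .
  assume pde: "\<forall>t>0. \<exists>f1 f2 f3 f4 :: real \<Rightarrow> real. \<forall>x\<in>{0<..<1}.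
             ((\<lambda>y. g t y) has_real_derivative f1 x) (at x) \<and>
             (f1 has_real_derivative f2 x) (at x) \<and>
             (f2 has_real_derivative f3 x) (at x) \<and>
             (f3 has_real_derivative f4 x) (at x) \<and>
             ((\<lambda>s. g s x) has_real_derivative (a * f4 x)) (at t)"
  define S where "S t x = {\<omega>\<in>space M. \<forall>s\<in>{0..t}. ibm Xp Xm Y x s \<omega> \<in> {0<..<1}}" for t x
  have g: "g t x = prob (S t x)" for t x
    unfolding assms(2) survival_event_eq[OF BM] S_def ..
  have antitone: "g t x \<le> g s x" if "0 < s" "s \<le> t" for s t x
    unfolding g using survival_event_sets[OF BM \<open>0 < s\<close>] that by (intro finite_measure_mono) (auto simp: S_def)
  \<comment> \<open>The equation is used at this single time only, with the spatial derivatives that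
    belong to it.\<close>
  obtain t where t: "0 < t" "0 < g t (1/2)"
    using survival_prob_positive[OF BM, of "1/2"] unfolding g S_def by auto
  obtain f1 f2 f3 f4 where f:
    "\<And>x. x \<in> {0<..<1} \<Longrightarrow> (g t has_real_derivative f1 x) (at x)"
    "\<And>x. x \<in> {0<..<1} \<Longrightarrow> (f1 has_real_derivative f2 x) (at x)"
    "\<And>x. x \<in> {0<..<1} \<Longrightarrow> (f2 has_real_derivative f3 x) (at x)"
    "\<And>x. x \<in> {0<..<1} \<Longrightarrow> (f3 has_real_derivative f4 x) (at x)"
    "\<And>x. x \<in> {0<..<1} \<Longrightarrow> ((\<lambda>s. g s x) has_real_derivative (a * f4 x)) (at t)"
    using pde[rule_format, OF t(1)] by blast
  have f4: "f4 x \<le> 0" if x: "x \<in> {0<..<1}" for x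
  proof (rule ccontr)
    assume "\<not> f4 x \<le> 0"
    then have "0 < a * f4 x" using \<open>a > 0\<close> by simp
    then obtain d where d: "0 < d" "\<And>h. \<lbrakk>0 < h; h < d\<rbrakk> \<Longrightarrow> g t x < g (t + h) x"
      using DERIV_pos_inc_right[OF f(5)[OF x]] by blast
    have "g t x < g (t + d/2) x" using d by simp
    also have "\<dots> \<le> g t x" using antitone t(1) d(1) by simp
    finally show False by simp
  qed
  \<comment> \<open>The first bound keeps the path above 0, the second below 1. Near the right end
    the second is used with \<open>x = 1 - y ^ 3\<close>, where the distance left is again
    \<open>y ^ 3\<close>.\<close>
  have stay: "- 1 * two_sided Xp Xm (Y s \<omega>) \<omega> < x" "1 * two_sided Xp Xm (Y s \<omega>) \<omega> < 1 - x"
    if "\<omega> \<in> S t x" "s \<in> {0..t}" for \<omega> s x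
  proof -
    have "x + two_sided Xp Xm (Y s \<omega>) \<omega> \<in> {0<..<1}" using that by (simp add: S_def ibm_def)
    then show "- 1 * two_sided Xp Xm (Y s \<omega>) \<omega> < x" "1 * two_sided Xp Xm (Y s \<omega>) \<omega> < 1 - x"
      by auto
  qed
  have S_space: "S t x \<subseteq> space M" for x by (auto simp: S_def)
  have "((\<lambda>x. g t x / x) \<longlongrightarrow> 0) (at_right 0)"
  proof (rule tendsto_quotient_zero_if_power4_bound)
    fix y :: real assume "0 < y"
    then show "g t (y ^ 3) \<le> (9 + 18 / sqrt t + 4 / t) * y ^ 4"
      unfolding g using t stay(1) by (intro ibm_stays_below_prob_le_power4[OF BM, of "-1"] S_space) blast+
  qed (simp add: g)
  moreover have "((\<lambda>x. g t (1 - x) / x) \<longlongrightarrow> 0) (at_right 0)"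
  proof (rule tendsto_quotient_zero_if_power4_bound)
    fix y :: real assume "0 < y"
    then show "g t (1 - y ^ 3) \<le> (9 + 18 / sqrt t + 4 / t) * y ^ 4"
      unfolding g using t stay(2)[of _ "1 - y ^ 3"]
      by (intro ibm_stays_below_prob_le_power4[OF BM, of 1] S_space) simp_all
  qed (simp add: g)
  ultimately have "g t (1/2) = 0"
    using f f4 by (intro nonneg_fourth_derivative_nonpos_imp_zero[of "g t" f1 f2 f3 f4]) (auto simp: g)
  then show False using t(2) by simp
qed

end
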